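(* Let $X=AU_1$ and $Y=BU_2$ be two GGCs, where $A$ and $B$ are nonnegative random variables, $A$ and $B$ are independent of $U_1$ and $U_2$, and $U_j\sim\mathrm{Gamma}(m_j,1)$ with $m_j>0$, $j=1,2$. If $m_1\le m_2$ and $A\leq_{\mathrm{Lt}}B$, then $X\leq_{\mathrm{Lt}}Y$.
   Context: $\mathrm{Gamma}(D,\theta)$ denotes the Gamma distribution with shape $D$ and rate $\theta$, with density $\theta^Dx^{D-1}e^{-\theta x}/\Gamma(D)$ on $(0,\infty)$. A GGC (generalized gamma convolution) here is a nonnegative random variable $X$ with $\mathbb{E}[e^{-sX}]=\exp\left(-\int_0^\infty\log(1+s/u)\,\mu(du)\right)$ for $s\ge0$, where $\mu$ is a nonzero nonnegative measure on $(0,\infty)$ with $\int_{(0,1]}|\log u|\,\mu(du)+\int_{(1,\infty)}u^{-1}\,\mu(du)<\infty$. Laplace transform order: for nonnegative random variables, $X\leq_{\mathrm{Lt}}Y$ means $\mathbb{E}[e^{-\rho X}]\ge\mathbb{E}[e^{-\rho Y}]$ for all $\rho\ge0$. *)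

theory Defs
  imports "HOL-Probability.Probability"
begin

definition nonneg_rv :: "'a measure \<Rightarrow> ('a \<Rightarrow> real) \<Rightarrow> bool" where
  "nonneg_rv M X \<longleftrightarrow> X \<in> borel_measurable M \<and> (AE \<omega> in M. 0 \<le> X \<omega>)"

definition laplace_transform :: "'a measure \<Rightarrow> ('a \<Rightarrow> real) \<Rightarrow> real \<Rightarrow> real" where
  "laplace_transform M X s = (\<integral>\<omega>. exp (- s * X \<omega>) \<partial>M)"

(* The two variables may live on different probability spaces: only their laws matter. *)
definition laplace_order ::
  "'a measure \<Rightarrow> ('a \<Rightarrow> real) \<Rightarrow> 'b measure \<Rightarrow> ('b \<Rightarrow> real) \<Rightarrow> bool" where
  "laplace_order M X N Y \<longleftrightarrow>
     (\<forall>\<rho>\<ge>0. laplace_transform M X \<rho> \<ge> laplace_transform N Y \<rho>)"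

definition gamma_density :: "real \<Rightarrow> real \<Rightarrow> real \<Rightarrow> real" where
  "gamma_density D \<theta> x =
     (if x > 0 then \<theta> powr D * x powr (D - 1) * exp (- \<theta> * x) / Gamma D else 0)"

definition gamma_distributed :: "'a measure \<Rightarrow> ('a \<Rightarrow> real) \<Rightarrow> real \<Rightarrow> real \<Rightarrow> bool" where
  "gamma_distributed M U D \<theta> \<longleftrightarrow> distributed M lborel U (\<lambda>x. ennreal (gamma_density D \<theta> x))"

(* mu is a measure on the half-line itself, with its Borel sets; it may be infinite. *)
definition thorin_measure :: "real measure \<Rightarrow> bool" where
  "thorin_measure \<mu> \<longleftrightarrow>
     sets \<mu> = sets (restrict_space borel {0<..}) \<and>
     emeasure \<mu> {0<..} \<noteq> 0 \<and>
     (\<integral>\<^sup>+u\<in>{0<..1}. ennreal \<bar>ln u\<bar> \<partial>\<mu>) + (\<integral>\<^sup>+u\<in>{1<..}. ennreal (1 / u) \<partial>\<mu>) < \<infinity>"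

(* The exponent is required to be integrable because the Bochner integral of a
   non-integrable function is 0. With the convention exp (- infinity) = 0 this is no
   restriction, since the Laplace transform on the left is positive. The conditions on
   a Thorin measure alone do not give it: they allow infinite mass at u = 1, where
   ln u vanishes. *)
definition ggc :: "'a measure \<Rightarrow> ('a \<Rightarrow> real) \<Rightarrow> bool" where
  "ggc M X \<longleftrightarrow>
     nonneg_rv M X \<and>
     (\<exists>\<mu>. thorin_measure \<mu> \<and>
        (\<forall>s\<ge>0. integrable \<mu> (\<lambda>u. ln (1 + s / u)) \<and>
           laplace_transform M X s = exp (- (\<integral>u. ln (1 + s / u) \<partial>\<mu>))))"

end

theory Submission
  imports Defs
begin

text \<open>
  Conditioning on \<open>U\<^sub>1\<close> gives \<open>E[exp (- \<rho> A U\<^sub>1)] = E[L\<^sub>A (\<rho> U\<^sub>1)] \<ge> E[L\<^sub>B (\<rho> U\<^sub>1)]\<close>. Integrating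
  the other way round, with the Gamma Laplace transform \<open>(1 + c) powr (- m)\<close>, the right-hand side is
  \<open>E[(1 + \<rho> B) powr (- m\<^sub>1)] \<ge> E[(1 + \<rho> B) powr (- m\<^sub>2)] = E[exp (- \<rho> B U\<^sub>2)]\<close>.
\<close>

lemma gamma_density_measurable [measurable]: "gamma_density D \<theta> \<in> borel_measurable borel"
  unfolding gamma_density_def by measurable

lemma gamma_density_nonneg: "0 < D \<Longrightarrow> 0 \<le> gamma_density D \<theta> x"
  by (simp add: gamma_density_def Gamma_real_nonneg)

text \<open>The Laplace transform of the Gamma law with shape \<open>m\<close> and rate 1, from the
  substitution \<open>t = (1 + c) * u\<close> in Euler's integral for \<open>Gamma m\<close>.
  Working with extended nonnegative integrals avoids integrability side conditions.\<close>

lemma nn_integral_gamma_density_exp: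
  fixes c m :: real
  assumes "0 < m" and "0 \<le> c"
  shows "(\<integral>\<^sup>+u. ennreal (gamma_density m 1 u) * ennreal (exp (- c * u)) \<partial>lborel)
         = ennreal ((1 + c) powr (- m))"
proof -
  let ?g = "\<lambda>t. ennreal (indicator {0..} t * t powr (m - 1) / exp t)"
  have pos: "0 < 1 + c" and Gpos: "0 < Gamma m"
    using assms by (auto intro: Gamma_real_pos)
  have "ennreal (Gamma m) = ennreal (1 + c) * (\<integral>\<^sup>+u. ?g ((1 + c) * u) \<partial>lborel)"
    using assms pos nn_integral_real_affine[of ?g "1 + c" 0]
    by (simp add: Gamma_conv_nn_integral_real)
  also have "\<dots> = (\<integral>\<^sup>+u. ennreal ((1 + c) powr m * Gamma m) *
      (ennreal (gamma_density m 1 u) * ennreal (exp (- c * u))) \<partial>lborel)"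
  proof (subst nn_integral_cmult[symmetric], measurable, intro nn_integral_cong)
    fix u :: real
    have "(1 + c) * (indicator {0..} ((1 + c) * u) * ((1 + c) * u) powr (m - 1) / exp ((1 + c) * u))
        = (1 + c) powr m * Gamma m * (gamma_density m 1 u * exp (- c * u))"
    proof (cases "u > 0")
      case True
      have "(1 + c) * (1 + c) powr (m - 1) = (1 + c) powr m"
        using pos by (simp add: powr_diff)
      moreover have "1 / exp ((1 + c) * u) = exp (- u) * exp (- c * u)"
        by (simp add: exp_minus exp_add algebra_simps divide_simps)
      moreover have "(1 + c) * (indicator {0..} ((1 + c) * u) * ((1 + c) * u) powr (m - 1) / exp ((1 + c) * u))
          = ((1 + c) * (1 + c) powr (m - 1)) * u powr (m - 1) * (1 / exp ((1 + c) * u))"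
        using True pos by (simp add: powr_mult)
      ultimately show ?thesis
        using True Gpos by (simp add: gamma_density_def)
    next
      \<comment> \<open>For \<open>u < 0\<close> both sides vanish by definition. At
        \<open>u = 0\<close> the indicator is 1 but the density is 0; they still agree because
        \<open>0 powr (m - 1) = 0\<close> by convention.\<close>
      case False
      then show ?thesis
        using pos by (cases "u = 0") (auto simp: gamma_density_def indicator_def zero_le_mult_iff)
    qed
    then show "ennreal (1 + c) * ?g ((1 + c) * u) = ennreal ((1 + c) powr m * Gamma m) *
        (ennreal (gamma_density m 1 u) * ennreal (exp (- c * u)))"
      using pos Gpos \<open>0 < m\<close>
      by (simp add: ennreal_mult'[symmetric] gamma_density_nonneg del: ennreal_plus)
  qed
  also have "\<dots> = ennreal ((1 + c) powr m * Gamma m) *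
      (\<integral>\<^sup>+u. ennreal (gamma_density m 1 u) * ennreal (exp (- c * u)) \<partial>lborel)"
    by (rule nn_integral_cmult) measurable
  finally have eq: "ennreal (Gamma m) = ennreal ((1 + c) powr m * Gamma m) *
      (\<integral>\<^sup>+u. ennreal (gamma_density m 1 u) * ennreal (exp (- c * u)) \<partial>lborel)" (is "_ = _ * ?I") .
  \<comment> \<open>Finiteness of \<open>?I\<close> is not yet known, so the constant is cancelled
    by multiplying with its finite positive reciprocal.\<close>
  have "?I = ennreal ((1 + c) powr (- m) / Gamma m) * (ennreal ((1 + c) powr m * Gamma m) * ?I)"
    using pos Gpos by (simp add: mult.assoc[symmetric] ennreal_mult'[symmetric] powr_minus)
  also have "\<dots> = ennreal ((1 + c) powr (- m))"
    unfolding eq[symmetric] using pos Gpos by (simp add: ennreal_mult'[symmetric])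
  finally show ?thesis .
qed

text \<open>Tonelli: integrating over \<open>u\<close> first leaves the Gamma Laplace transform at
  \<open>c = \<rho> * A \<omega>\<close>, which is nonnegative for almost every
  \<open>\<omega>\<close>.\<close>

lemma nn_integral_gamma_mixture:
  assumes "sigma_finite_measure M" and A: "nonneg_rv M A" and "0 < m" and "0 \<le> \<rho>"
  shows "(\<integral>\<^sup>+u. ennreal (gamma_density m 1 u) * (\<integral>\<^sup>+\<omega>. ennreal (exp (- (\<rho> * u) * A \<omega>)) \<partial>M) \<partial>lborel)
         = (\<integral>\<^sup>+\<omega>. ennreal ((1 + \<rho> * A \<omega>) powr (- m)) \<partial>M)"
proof -
  interpret sigma_finite_measure M by fact
  interpret P: pair_sigma_finite lborel M ..
  have [measurable]: "A \<in> borel_measurable M" and nonneg: "AE \<omega> in M. 0 \<le> A \<omega>"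
    using A by (auto simp: nonneg_rv_def)
  have "(\<integral>\<^sup>+u. ennreal (gamma_density m 1 u) * (\<integral>\<^sup>+\<omega>. ennreal (exp (- (\<rho> * u) * A \<omega>)) \<partial>M) \<partial>lborel)
      = (\<integral>\<^sup>+u. \<integral>\<^sup>+\<omega>. ennreal (gamma_density m 1 u) * ennreal (exp (- (\<rho> * u) * A \<omega>)) \<partial>M \<partial>lborel)"
    by (intro nn_integral_cong nn_integral_cmult[symmetric]) measurable
  also have "\<dots> = (\<integral>\<^sup>+\<omega>. \<integral>\<^sup>+u. ennreal (gamma_density m 1 u) * ennreal (exp (- (\<rho> * u) * A \<omega>)) \<partial>lborel \<partial>M)"
    by (rule P.Fubini'[symmetric]) measurable
  also have "\<dots> = (\<integral>\<^sup>+\<omega>. ennreal ((1 + \<rho> * A \<omega>) powr (- m)) \<partial>M)"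
  proof (rule nn_integral_cong_AE, use nonneg in eventually_elim)
    case (elim \<omega>)
    then show ?case
      using nn_integral_gamma_density_exp[of m "\<rho> * A \<omega>"] assms by (simp add: mult_ac)
  qed
  finally show ?thesis .
qed

text \<open>No integrability is assumed: an infinite integral gives 0 on both sides.\<close>

lemma laplace_transform_conv_nn_integral:
  assumes "X \<in> borel_measurable M"
  shows "laplace_transform M X s = enn2real (\<integral>\<^sup>+\<omega>. ennreal (exp (- s * X \<omega>)) \<partial>M)"
  using assms unfolding laplace_transform_def by (intro integral_eq_nn_integral) auto

text \<open>The integrand is almost surely at most 1 and the total mass is 1, so the integral is
  finite. This lets inequalities pass between real Laplace transforms and extended nonnegative
  integrals.\<close>

lemma (in prob_space) ennreal_laplace_transform:
  assumes "nonneg_rv M X" and "0 \<le> s"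
  shows "ennreal (laplace_transform M X s) = (\<integral>\<^sup>+\<omega>. ennreal (exp (- s * X \<omega>)) \<partial>M)"
proof -
  have "AE \<omega> in M. exp (- s * X \<omega>) \<le> 1"
    using assms by (auto simp: nonneg_rv_def)
  then have "(\<integral>\<^sup>+\<omega>. ennreal (exp (- s * X \<omega>)) \<partial>M) \<le> (\<integral>\<^sup>+\<omega>. 1 \<partial>M)"
    by (intro nn_integral_mono_AE) auto
  then have "(\<integral>\<^sup>+\<omega>. ennreal (exp (- s * X \<omega>)) \<partial>M) < \<top>"
    by (auto simp: emeasure_space_1 intro: le_less_trans)
  then show ?thesis
    using assms by (simp add: laplace_transform_conv_nn_integral nonneg_rv_def)
qed

text \<open>Conditioning on \<open>U\<close>: independence turns the joint law into a product, so
  \<open>A\<close> can be integrated out with \<open>U\<close> frozen at \<open>u\<close>, and then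
  the law of \<open>U\<close> is replaced by its density.\<close>

lemma (in prob_space) nn_integral_exp_mult_gamma:
  assumes indep: "indep_var borel A borel U" and U: "gamma_distributed M U m 1"
  shows "(\<integral>\<^sup>+\<omega>. ennreal (exp (- \<rho> * (A \<omega> * U \<omega>))) \<partial>M)
    = (\<integral>\<^sup>+u. ennreal (gamma_density m 1 u) * (\<integral>\<^sup>+\<omega>. ennreal (exp (- (\<rho> * u) * A \<omega>)) \<partial>M) \<partial>lborel)"
proof -
  have [measurable]: "A \<in> borel_measurable M" "U \<in> borel_measurable M"
    and pair: "distr M borel A \<Otimes>\<^sub>M distr M borel U = distr M (borel \<Otimes>\<^sub>M borel) (\<lambda>\<omega>. (A \<omega>, U \<omega>))"
    using indep by (auto simp: indep_var_distribution_eq)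
  interpret A: prob_space "distr M borel A" by (rule prob_space_distr) measurable
  interpret U: prob_space "distr M borel U" by (rule prob_space_distr) measurable
  interpret P: pair_sigma_finite "distr M borel A" "distr M borel U" ..
  have "(\<integral>\<^sup>+\<omega>. ennreal (exp (- \<rho> * (A \<omega> * U \<omega>))) \<partial>M)
      = (\<integral>\<^sup>+p. ennreal (exp (- \<rho> * (fst p * snd p))) \<partial>(distr M borel A \<Otimes>\<^sub>M distr M borel U))"
    unfolding pair by (subst nn_integral_distr) auto
  also have "\<dots> = (\<integral>\<^sup>+u. \<integral>\<^sup>+a. ennreal (exp (- \<rho> * (a * u))) \<partial>distr M borel A \<partial>distr M borel U)"
    by (subst P.nn_integral_snd[symmetric]) auto
  \<comment> \<open>Each marginal law is pulled back to \<open>M\<close> separately, so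
    \<open>A\<close> and \<open>U\<close> are now evaluated at unrelated sample points.\<close>
  also have "\<dots> = (\<integral>\<^sup>+\<omega>'. (\<integral>\<^sup>+\<omega>. ennreal (exp (- (\<rho> * U \<omega>') * A \<omega>)) \<partial>M) \<partial>M)"
    by (simp add: nn_integral_distr mult_ac)
  also have "\<dots> = (\<integral>\<^sup>+u. ennreal (gamma_density m 1 u) * (\<integral>\<^sup>+\<omega>. ennreal (exp (- (\<rho> * u) * A \<omega>)) \<partial>M) \<partial>lborel)"
    using U unfolding gamma_distributed_def
    by (intro distributed_nn_integral[symmetric]) auto
  finally show ?thesis .
qed

theorem proposition6:
  fixes M :: "'a measure" and N :: "'b measure"
    and X A U1 :: "'a \<Rightarrow> real" and Y B U2 :: "'b \<Rightarrow> real"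
    and m1 m2 :: real
  assumes "prob_space M" and "prob_space N"
    and "nonneg_rv M A" and "nonneg_rv N B"
    and "m1 > 0" and "m2 > 0"
    and "gamma_distributed M U1 m1 1" and "gamma_distributed N U2 m2 1"
    and "prob_space.indep_var M borel A borel U1"
    and "prob_space.indep_var N borel B borel U2"
    and "X = (\<lambda>\<omega>. A \<omega> * U1 \<omega>)" and "Y = (\<lambda>\<omega>. B \<omega> * U2 \<omega>)"
    and "ggc M X" and "ggc N Y"
    and "m1 \<le> m2" and "laplace_order M A N B"
  shows "laplace_order M X N Y"
proof -
  interpret M: prob_space M by fact
  interpret N: prob_space N by fact
  note nonneg = \<open>nonneg_rv M A\<close> \<open>nonneg_rv N B\<close>
  have B0: "AE \<omega> in N. 0 \<le> B \<omega>"
    using nonneg by (simp add: nonneg_rv_def)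
  show ?thesis
    unfolding laplace_order_def
  proof (intro allI impI)
    fix \<rho> :: real
    assume \<rho>: "0 \<le> \<rho>"
    have X: "(\<integral>\<^sup>+\<omega>. ennreal (exp (- \<rho> * X \<omega>)) \<partial>M)
        = (\<integral>\<^sup>+u. ennreal (gamma_density m1 1 u) * (\<integral>\<^sup>+\<omega>. ennreal (exp (- (\<rho> * u) * A \<omega>)) \<partial>M) \<partial>lborel)"
      unfolding \<open>X = _\<close> by (rule M.nn_integral_exp_mult_gamma) fact+
    have "(\<integral>\<^sup>+\<omega>. ennreal (exp (- \<rho> * Y \<omega>)) \<partial>N)
        = (\<integral>\<^sup>+u. ennreal (gamma_density m2 1 u) * (\<integral>\<^sup>+\<omega>. ennreal (exp (- (\<rho> * u) * B \<omega>)) \<partial>N) \<partial>lborel)"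
      unfolding \<open>Y = _\<close> by (rule N.nn_integral_exp_mult_gamma) fact+
    also have "\<dots> = (\<integral>\<^sup>+\<omega>. ennreal ((1 + \<rho> * B \<omega>) powr (- m2)) \<partial>N)"
      by (rule nn_integral_gamma_mixture) (unfold_locales, fact+)
    \<comment> \<open>Almost surely the base \<open>1 + \<rho> * B \<omega>\<close> is at least 1,
      so the power increases with its exponent, and \<open>- m2 \<le> - m1\<close>.\<close>
    also have "\<dots> \<le> (\<integral>\<^sup>+\<omega>. ennreal ((1 + \<rho> * B \<omega>) powr (- m1)) \<partial>N)"
      by (rule nn_integral_mono_AE, use B0 in eventually_elim)
        (use \<rho> \<open>m1 \<le> m2\<close> in \<open>auto intro!: ennreal_leI powr_mono\<close>)
    \<comment> \<open>The mixture formula read backwards with shape \<open>m1\<close>. The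
      intermediate quantity is the transform of \<open>B\<close> times an independent Gamma variable
      of shape \<open>m1\<close>; no such variable has to exist on \<open>N\<close>.\<close>
    also have "\<dots> = (\<integral>\<^sup>+u. ennreal (gamma_density m1 1 u) * (\<integral>\<^sup>+\<omega>. ennreal (exp (- (\<rho> * u) * B \<omega>)) \<partial>N) \<partial>lborel)"
      by (rule nn_integral_gamma_mixture[symmetric]) (unfold_locales, fact+)
    also have "\<dots> \<le> (\<integral>\<^sup>+u. ennreal (gamma_density m1 1 u) * (\<integral>\<^sup>+\<omega>. ennreal (exp (- (\<rho> * u) * A \<omega>)) \<partial>M) \<partial>lborel)"
    proof (rule nn_integral_mono)
      fix u :: real
      show "ennreal (gamma_density m1 1 u) * (\<integral>\<^sup>+\<omega>. ennreal (exp (- (\<rho> * u) * B \<omega>)) \<partial>N)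
          \<le> ennreal (gamma_density m1 1 u) * (\<integral>\<^sup>+\<omega>. ennreal (exp (- (\<rho> * u) * A \<omega>)) \<partial>M)"
      \<comment> \<open>The order between \<open>A\<close> and \<open>B\<close> is used at the
        argument \<open>\<rho> * u\<close>, hence for \<open>u > 0\<close>; elsewhere the density is
        0.\<close>
      proof (cases "u > 0")
        case True
        then have "0 \<le> \<rho> * u"
          using \<rho> by simp
        then have "(\<integral>\<^sup>+\<omega>. ennreal (exp (- (\<rho> * u) * B \<omega>)) \<partial>N) \<le> (\<integral>\<^sup>+\<omega>. ennreal (exp (- (\<rho> * u) * A \<omega>)) \<partial>M)"
          using \<open>laplace_order M A N B\<close> nonneg unfolding laplace_order_def
          by (simp only: M.ennreal_laplace_transform[symmetric] N.ennreal_laplace_transform[symmetric] ennreal_leI)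
        then show ?thesis
          by (rule mult_left_mono) simp
      qed (simp add: gamma_density_def)
    qed
    finally have le: "(\<integral>\<^sup>+\<omega>. ennreal (exp (- \<rho> * Y \<omega>)) \<partial>N) \<le> (\<integral>\<^sup>+\<omega>. ennreal (exp (- \<rho> * X \<omega>)) \<partial>M)"
      unfolding X .
    \<comment> \<open>Nonnegativity of \<open>X\<close> and \<open>Y\<close>, part of being a GGC,
      makes both integrals in \<open>le\<close> finite, so the inequality descends to the real
      Laplace transforms.\<close>
    have "nonneg_rv M X" "nonneg_rv N Y"
      using \<open>ggc M X\<close> \<open>ggc N Y\<close> by (auto simp: ggc_def)
    then show "laplace_transform N Y \<rho> \<le> laplace_transform M X \<rho>"
      using le \<rho> by (simp only: M.ennreal_laplace_transform[symmetric] N.ennreal_laplace_transform[symmetric])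
        (simp add: ennreal_le_iff laplace_transform_def)
  qed
qed

end
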